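(* Let $G=\langle a,b,t \mid [a,b]=1,\ t^2=1,\ tat=b\rangle\cong\mathbb Z^2\rtimes\mathbb Z/2\mathbb Z$, a virtually abelian group, with generating set $Z=\{a^{\pm1},b^{\pm1},t\}$. Then $\mathrm{ConjGeo}_Z(G)$ is a regular language, but $\mathrm{UConjGeo}_Z(G)$ is not a regular language. Thus, even for virtually abelian groups, regularity of $\mathrm{ConjGeo}$ does not imply regularity of $\mathrm{UConjGeo}$ with respect to the same generating set.
   Context: $Z^*$ is the free monoid on $Z$, $\ell(w)$ is the length of a word $w\in Z^*$, and $\pi\colon Z^*\to G$ is the canonical surjective homomorphism (note that $Z$ is closed under inverses, since $t^{-1}=t$). For $g\in G$, $[g]$ denotes the conjugacy class of $g$ in $G$. A word $w\in Z^*$ is a geodesic if $\ell(w)\le\ell(u)$ for every $u\in Z^*$ with $u\pi=w\pi$; $\mathrm{Geo}_Z(G)$ is the set of all geodesics. $\mathrm{ConjGeo}_Z(G)=\{w\in\mathrm{Geo}_Z(G):\ell(w)\le\ell(u)\text{ for all }u\in Z^*\text{ with }[w\pi]=[u\pi]\}$. $\mathrm{UConj}$ is the equivalence relation on $G$ defined by: $(g,h)\in\mathrm{UConj}$ iff $g=h$, or both $[g]$ and $[h]$ have more than one element (i.e. both $g$ and $h$ are noncentral). $\mathrm{UConjGeo}_Z(G)=\{w\in\mathrm{Geo}_Z(G):\ell(w)\le\ell(u)\text{ for all }u\in\mathrm{Geo}_Z(G)\text{ with }(w\pi,u\pi)\in\mathrm{UConj}\}$. Languages are taken over the alphabet $Z$.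 *)

theory Defs
  imports "HOL-Algebra.Algebra"
begin

section \<open>Groups given by presentations\<close>

text \<open>
  A letter \<open>(x, True)\<close> stands for the generator \<open>x\<close> and \<open>(x, False)\<close> for its formal inverse.
  A set of relations is a set \<open>R\<close> of pairs of words, \<open>(u, v)\<close> standing for \<open>u = v\<close>; the
  set of generators is the whole type \<open>'g\<close>.
\<close>

type_synonym 'g gword = "('g \<times> bool) list"

inductive pres_eq :: "('g gword \<times> 'g gword) set \<Rightarrow> 'g gword \<Rightarrow> 'g gword \<Rightarrow> bool"
  for R where
  rel: "(u, v) \<in> R \<Longrightarrow> pres_eq R u v"
| cancel: "pres_eq R [(x, s), (x, \<not> s)] []"
| refl: "pres_eq R u u"
| sym: "pres_eq R u v \<Longrightarrow> pres_eq R v u"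
| trans: "pres_eq R u v \<Longrightarrow> pres_eq R v w \<Longrightarrow> pres_eq R u w"
| append: "pres_eq R u u' \<Longrightarrow> pres_eq R v v' \<Longrightarrow> pres_eq R (u @ v) (u' @ v')"

definition pres_class :: "('g gword \<times> 'g gword) set \<Rightarrow> 'g gword \<Rightarrow> 'g gword set" where
  "pres_class R u = {v. pres_eq R u v}"

definition presented_group :: "('g gword \<times> 'g gword) set \<Rightarrow> 'g gword set monoid" where
  "presented_group R =
     \<lparr>carrier = range (pres_class R),
      monoid.mult = (\<lambda>A B. \<Union>u\<in>A. \<Union>v\<in>B. pres_class R (u @ v)),
      one = pres_class R []\<rparr>"

lemma pres_class_eq_iff: "pres_class R u = pres_class R v \<longleftrightarrow> pres_eq R u v"
proof
  assume "pres_class R u = pres_class R v"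
  moreover have "v \<in> pres_class R v" by (simp add: pres_class_def pres_eq.refl)
  ultimately have "v \<in> pres_class R u" by simp
  then show "pres_eq R u v" by (simp add: pres_class_def)
next
  assume uv: "pres_eq R u v"
  have "pres_eq R u w \<longleftrightarrow> pres_eq R v w" for w
    using pres_eq.trans[OF uv] pres_eq.trans[OF pres_eq.sym[OF uv]] by blast
  then show "pres_class R u = pres_class R v" by (simp add: pres_class_def)
qed

lemma presented_group_mult:
  "pres_class R u \<otimes>\<^bsub>presented_group R\<^esub> pres_class R v = pres_class R (u @ v)"
proof -
  have "pres_class R (u' @ v') = pres_class R (u @ v)"
    if "u' \<in> pres_class R u" "v' \<in> pres_class R v" for u' v'
    using that unfolding pres_class_eq_iff
    by (simp add: pres_class_def pres_eq.sym pres_eq.append)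
  moreover have "u \<in> pres_class R u" "v \<in> pres_class R v"
    by (simp_all add: pres_class_def pres_eq.refl)
  ultimately have "(\<Union>u'\<in>pres_class R u. \<Union>v'\<in>pres_class R v. pres_class R (u' @ v')) =
      pres_class R (u @ v)" by blast
  then show ?thesis by (simp add: presented_group_def)
qed

lemma pres_eq_inverse: "pres_eq R (rev (map (\<lambda>(x, s). (x, \<not> s)) u) @ u) []"
proof (induction u)
  case Nil
  show ?case by (simp add: pres_eq.refl)
next
  case (Cons p u)
  obtain x s where p: "p = (x, s)" by fastforce
  let ?i = "rev (map (\<lambda>(x, s). (x, \<not> s)) u)"
  have "pres_eq R ([(x, \<not> s), (x, \<not> \<not> s)] @ u) ([] @ u)"
    by (rule pres_eq.append[OF pres_eq.cancel pres_eq.refl])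
  then have "pres_eq R (?i @ ([(x, \<not> s), (x, \<not> \<not> s)] @ u)) (?i @ ([] @ u))"
    by (rule pres_eq.append[OF pres_eq.refl])
  then have "pres_eq R (rev (map (\<lambda>(x, s). (x, \<not> s)) (p # u)) @ (p # u)) (?i @ u)"
    by (simp add: p)
  then show ?case using Cons.IH by (rule pres_eq.trans)
qed

lemma carrier_presented_group: "carrier (presented_group R) = range (pres_class R)"
  by (simp add: presented_group_def)

lemma one_presented_group: "\<one>\<^bsub>presented_group R\<^esub> = pres_class R []"
  by (simp add: presented_group_def)

lemma group_presented_group: "group (presented_group R)"
proof (rule groupI)
  fix x assume "x \<in> carrier (presented_group R)"
  then obtain u where x: "x = pres_class R u" by (auto simp: carrier_presented_group)
  let ?i = "pres_class R (rev (map (\<lambda>(x, s). (x, \<not> s)) u))"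
  have "?i \<otimes>\<^bsub>presented_group R\<^esub> x = \<one>\<^bsub>presented_group R\<^esub>"
    unfolding x presented_group_mult one_presented_group pres_class_eq_iff
    by (rule pres_eq_inverse)
  then show "\<exists>y\<in>carrier (presented_group R). y \<otimes>\<^bsub>presented_group R\<^esub> x = \<one>\<^bsub>presented_group R\<^esub>"
    by (intro bexI[of _ ?i]) (simp_all add: carrier_presented_group)
qed (auto simp: carrier_presented_group one_presented_group presented_group_mult)

section \<open>Semidirect products and virtually abelian groups\<close>

definition semidirect_product ::
    "('a, 'm) monoid_scheme \<Rightarrow> ('b, 'n) monoid_scheme \<Rightarrow> ('b \<Rightarrow> 'a \<Rightarrow> 'a) \<Rightarrow> ('a \<times> 'b) monoid" where
  "semidirect_product N H \<phi> =
     \<lparr>carrier = carrier N \<times> carrier H,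
      monoid.mult = (\<lambda>(n, h) (n', h'). (n \<otimes>\<^bsub>N\<^esub> \<phi> h n', h \<otimes>\<^bsub>H\<^esub> h')),
      one = (\<one>\<^bsub>N\<^esub>, \<one>\<^bsub>H\<^esub>)\<rparr>"

definition virtually_abelian :: "('a, 'm) monoid_scheme \<Rightarrow> bool" where
  "virtually_abelian G \<longleftrightarrow>
     (\<exists>H. subgroup H G \<and> comm_group (G\<lparr>carrier := H\<rparr>) \<and> finite (rcosets\<^bsub>G\<^esub> H))"

section \<open>Regular languages\<close>

text \<open>
  Acceptance by a complete deterministic finite automaton. States are natural numbers, which
  loses no generality because the state set is finite.
\<close>

definition regular_language :: "'z set \<Rightarrow> 'z list set \<Rightarrow> bool" where
  "regular_language Z L \<longleftrightarrow>
     (\<exists>(Q :: nat set) q\<^sub>0 \<delta> F.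
        finite Q \<and> q\<^sub>0 \<in> Q \<and> F \<subseteq> Q \<and> (\<forall>q\<in>Q. \<forall>z\<in>Z. \<delta> q z \<in> Q) \<and>
        L = {w \<in> lists Z. foldl \<delta> q\<^sub>0 w \<in> F})"

section \<open>Geodesics and conjugacy geodesics\<close>

definition symmetric_generating_set :: "('a, 'm) monoid_scheme \<Rightarrow> 'a set \<Rightarrow> bool" where
  "symmetric_generating_set G Z \<longleftrightarrow>
     Z \<subseteq> carrier G \<and> (\<forall>z\<in>Z. inv\<^bsub>G\<^esub> z \<in> Z) \<and> generate G Z = carrier G"

text \<open>Words over \<open>Z \<subseteq> carrier G\<close> are elements of \<open>lists Z\<close>; \<open>word_val G\<close> is the map \<open>\<pi>\<close>.\<close>

definition word_val :: "('a, 'm) monoid_scheme \<Rightarrow> 'a list \<Rightarrow> 'a" where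
  "word_val G w = foldr (\<lambda>x y. x \<otimes>\<^bsub>G\<^esub> y) w \<one>\<^bsub>G\<^esub>"

definition conj_class :: "('a, 'm) monoid_scheme \<Rightarrow> 'a \<Rightarrow> 'a set" where
  "conj_class G g = {x \<otimes>\<^bsub>G\<^esub> g \<otimes>\<^bsub>G\<^esub> inv\<^bsub>G\<^esub> x | x. x \<in> carrier G}"

definition Geo :: "('a, 'm) monoid_scheme \<Rightarrow> 'a set \<Rightarrow> 'a list set" where
  "Geo G Z = {w \<in> lists Z. \<forall>u\<in>lists Z. word_val G u = word_val G w \<longrightarrow> length w \<le> length u}"

definition ConjGeo :: "('a, 'm) monoid_scheme \<Rightarrow> 'a set \<Rightarrow> 'a list set" where
  "ConjGeo G Z = {w \<in> Geo G Z. \<forall>u\<in>lists Z.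
     conj_class G (word_val G w) = conj_class G (word_val G u) \<longrightarrow> length w \<le> length u}"

text \<open>
  ``More than one element'' is not expressed with \<open>card\<close>, which is \<open>0\<close> on infinite classes.
\<close>

definition UConj :: "('a, 'm) monoid_scheme \<Rightarrow> ('a \<times> 'a) set" where
  "UConj G = {(g, h). g \<in> carrier G \<and> h \<in> carrier G \<and>
     (g = h \<or> ((\<exists>x\<in>conj_class G g. \<exists>y\<in>conj_class G g. x \<noteq> y) \<and>
               (\<exists>x\<in>conj_class G h. \<exists>y\<in>conj_class G h. x \<noteq> y)))}"

definition UConjGeo :: "('a, 'm) monoid_scheme \<Rightarrow> 'a set \<Rightarrow> 'a list set" where
  "UConjGeo G Z = {w \<in> Geo G Z. \<forall>u\<in>Geo G Z.
     (word_val G w, word_val G u) \<in> UConj G \<longrightarrow> length w \<le> length u}"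

section \<open>The group \<open>\<langle>a, b, t | [a,b] = 1, t\<^sup>2 = 1, tat = b\<rangle>\<close>\<close>

datatype gen = gen_a | gen_b | gen_t

definition G_rels :: "(gen gword \<times> gen gword) set" where
  "G_rels =
     {([(gen_a, True), (gen_b, True), (gen_a, False), (gen_b, False)], []),
      ([(gen_t, True), (gen_t, True)], []),
      ([(gen_t, True), (gen_a, True), (gen_t, True)], [(gen_b, True)])}"

definition G_ex :: "gen gword set monoid" where
  "G_ex = presented_group G_rels"

definition el_a :: "gen gword set" where "el_a = pres_class G_rels [(gen_a, True)]"
definition el_b :: "gen gword set" where "el_b = pres_class G_rels [(gen_b, True)]"
definition el_t :: "gen gword set" where "el_t = pres_class G_rels [(gen_t, True)]"

definition Z_ex :: "gen gword set set" where
  "Z_ex = {el_a, inv\<^bsub>G_ex\<^esub> el_a, el_b, inv\<^bsub>G_ex\<^esub> el_b, el_t}"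

text \<open>The generator \<open>1\<close> of \<open>\<int>/2\<int>\<close> acts on \<open>\<int>\<^sup>2\<close> by exchanging the coordinates.\<close>

definition swap_action :: "int \<Rightarrow> int \<times> int \<Rightarrow> int \<times> int" where
  "swap_action k p = (if k = 0 then p else (snd p, fst p))"

definition Z2_semidirect_C2 :: "((int \<times> int) \<times> int) monoid" where
  "Z2_semidirect_C2 =
     semidirect_product (integer_group \<times>\<times> integer_group) (integer_mod_group 2) swap_action"

end

theory Submission
  imports Defs
begin

text \<open>
  In the coordinates \<open>a\<^sup>m b\<^sup>n t\<^sup>e \<mapsto> ((m, n), e)\<close> the word length is \<open>\<bar>m\<bar> + \<bar>n\<bar> + e\<close>. Conjugation
  identifies \<open>((m, n), 0)\<close> with \<open>((n, m), 0)\<close>, and the class of \<open>((m, n), 1)\<close> is determined by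
  \<open>m + n\<close>, so its minimal length is \<open>\<bar>m + n\<bar> + 1\<close>. Comparing with letter counts, a word is a
  conjugacy geodesic iff it has no \<open>t\<close> and contains no letter together with its inverse, or has one
  \<open>t\<close> and its other letters are all positive or all negative; this is decided by a finite automaton.

  The noncentral elements form a single uniform class with minimal length 1, while the centre
  consists of the elements \<open>a\<^sup>m b\<^sup>m\<close>. Hence \<open>a\<^sup>i b\<^sup>j\<close> with \<open>i + j \<ge> 2\<close> is a uniform conjugacy
  geodesic iff \<open>i = j\<close>, which no finite automaton can check.
\<close>

section \<open>The isomorphism with the semidirect product\<close>

abbreviation S_ex :: "((int \<times> int) \<times> int) monoid" where
  "S_ex \<equiv> Z2_semidirect_C2"

lemma carrier_S_ex: "carrier S_ex = UNIV \<times> {0, 1}"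
  by (auto simp: Z2_semidirect_C2_def semidirect_product_def carrier_integer_mod_group)

lemma one_S_ex: "\<one>\<^bsub>S_ex\<^esub> = ((0, 0), 0)"
  by (simp add: Z2_semidirect_C2_def semidirect_product_def)

lemma mult_S_ex:
  "((m, n), e) \<otimes>\<^bsub>S_ex\<^esub> ((m', n'), e') =
     ((m + (if e = 0 then m' else n'), n + (if e = 0 then n' else m')), (e + e') mod 2)"
  by (simp add: Z2_semidirect_C2_def semidirect_product_def swap_action_def)

lemma monoid_S_ex: "monoid S_ex"
  by (rule monoidI) (auto simp: carrier_S_ex one_S_ex mult_S_ex)

text \<open>Both signs of \<open>gen_t\<close> give the same element because the swap is an
  involution.\<close>

fun letter_val :: "gen \<times> bool \<Rightarrow> (int \<times> int) \<times> int" where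
  "letter_val (gen_a, s) = ((if s then 1 else -1, 0), 0)"
| "letter_val (gen_b, s) = ((0, if s then 1 else -1), 0)"
| "letter_val (gen_t, s) = ((0, 0), 1)"

section \<open>Evaluation of formal words in the semidirect product\<close>

definition gword_val :: "gen gword \<Rightarrow> (int \<times> int) \<times> int" where
  "gword_val u = word_val S_ex (map letter_val u)"

lemma letter_val_carrier: "letter_val p \<in> carrier S_ex"
  by (cases p rule: letter_val.cases) (auto simp: carrier_S_ex)

lemma gword_val_Nil: "gword_val [] = \<one>\<^bsub>S_ex\<^esub>"
  and gword_val_Cons: "gword_val (p # u) = letter_val p \<otimes>\<^bsub>S_ex\<^esub> gword_val u"
  by (simp_all add: gword_val_def word_val_def)

lemma gword_val_carrier: "gword_val u \<in> carrier S_ex"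
  by (induction u)
    (simp_all add: gword_val_Nil gword_val_Cons monoid.m_closed[OF monoid_S_ex]
      monoid.one_closed[OF monoid_S_ex] letter_val_carrier)

lemma gword_val_append: "gword_val (u @ v) = gword_val u \<otimes>\<^bsub>S_ex\<^esub> gword_val v"
  by (induction u)
    (simp_all add: gword_val_Nil gword_val_Cons monoid.m_assoc[OF monoid_S_ex]
      monoid.l_one[OF monoid_S_ex] letter_val_carrier gword_val_carrier)

text \<open>The three defining relations and free cancellation hold in the semidirect product, so
  evaluation factors through the presentation.\<close>

lemma gword_val_pres_eq: "pres_eq G_rels u v \<Longrightarrow> gword_val u = gword_val v"
proof (induction rule: pres_eq.induct)
  case (rel u v)
  then show ?case
    by (auto simp: G_rels_def gword_val_Nil gword_val_Cons one_S_ex mult_S_ex)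
next
  case (cancel x s)
  then show ?case
    by (cases x) (auto simp: gword_val_Nil gword_val_Cons one_S_ex mult_S_ex)
qed (simp_all add: gword_val_append)

text \<open>\<open>SOME\<close> picks a representative of the class; by
  \<open>gword_val_pres_eq\<close> the value does not depend on the choice.\<close>

definition coords :: "gen gword set \<Rightarrow> (int \<times> int) \<times> int" where
  "coords C = gword_val (SOME u. u \<in> C)"

lemma coords_pres_class: "coords (pres_class G_rels u) = gword_val u"
proof -
  have "u \<in> pres_class G_rels u" by (simp add: pres_class_def pres_eq.refl)
  then have "(SOME v. v \<in> pres_class G_rels u) \<in> pres_class G_rels u" by (rule someI)
  then show ?thesis
    by (simp add: coords_def pres_class_def gword_val_pres_eq[symmetric])
qed

interpretation G_ex: group G_ex
  by (simp add: G_ex_def group_presented_group)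

lemma carrier_G_ex: "carrier G_ex = range (pres_class G_rels)"
  and one_G_ex: "\<one>\<^bsub>G_ex\<^esub> = pres_class G_rels []"
  and mult_G_ex: "pres_class G_rels u \<otimes>\<^bsub>G_ex\<^esub> pres_class G_rels v = pres_class G_rels (u @ v)"
  by (simp_all add: G_ex_def carrier_presented_group one_presented_group presented_group_mult)

lemma coords_carrier: "g \<in> carrier G_ex \<Longrightarrow> coords g \<in> carrier S_ex"
  by (auto simp: carrier_G_ex coords_pres_class gword_val_carrier)

lemma coords_mult:
  "g \<in> carrier G_ex \<Longrightarrow> h \<in> carrier G_ex \<Longrightarrow>
     coords (g \<otimes>\<^bsub>G_ex\<^esub> h) = coords g \<otimes>\<^bsub>S_ex\<^esub> coords h"
  by (auto simp: carrier_G_ex mult_G_ex coords_pres_class gword_val_append)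

lemma coords_one: "coords \<one>\<^bsub>G_ex\<^esub> = ((0, 0), 0)"
  by (simp add: one_G_ex coords_pres_class gword_val_Nil one_S_ex)

section \<open>Relations between the generators\<close>

lemma el_closed [simp]: "el_a \<in> carrier G_ex" "el_b \<in> carrier G_ex" "el_t \<in> carrier G_ex"
  by (simp_all add: el_a_def el_b_def el_t_def carrier_G_ex)

lemma pres_class_inverse_letter:
  "pres_class G_rels [(x, False)] = inv\<^bsub>G_ex\<^esub> pres_class G_rels [(x, True)]"
proof -
  have "pres_eq G_rels [(x, False), (x, \<not> False)] []" by (rule pres_eq.cancel)
  then show ?thesis
    by (intro G_ex.inv_equality[symmetric])
      (auto simp: mult_G_ex one_G_ex pres_class_eq_iff carrier_G_ex)
qed

lemma el_t_squared: "el_t \<otimes>\<^bsub>G_ex\<^esub> el_t = \<one>\<^bsub>G_ex\<^esub>"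
  unfolding el_t_def mult_G_ex one_G_ex pres_class_eq_iff
  by (rule pres_eq.rel) (simp add: G_rels_def)

lemma el_t_el_a: "el_t \<otimes>\<^bsub>G_ex\<^esub> el_a = el_b \<otimes>\<^bsub>G_ex\<^esub> el_t"
proof -
  have "el_t \<otimes>\<^bsub>G_ex\<^esub> el_a \<otimes>\<^bsub>G_ex\<^esub> el_t = el_b"
    unfolding el_t_def el_a_def el_b_def mult_G_ex pres_class_eq_iff
    by (rule pres_eq.rel) (simp add: G_rels_def)
  then have "el_b \<otimes>\<^bsub>G_ex\<^esub> el_t = el_t \<otimes>\<^bsub>G_ex\<^esub> el_a \<otimes>\<^bsub>G_ex\<^esub> (el_t \<otimes>\<^bsub>G_ex\<^esub> el_t)"
    by (simp add: G_ex.m_assoc[symmetric])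
  then show ?thesis by (simp add: el_t_squared)
qed

text \<open>From \<open>ta = bt\<close> and \<open>t^2 = 1\<close>:
  \<open>tb = t(bt)t = t(ta)t = at\<close>.\<close>

lemma el_t_el_b: "el_t \<otimes>\<^bsub>G_ex\<^esub> el_b = el_a \<otimes>\<^bsub>G_ex\<^esub> el_t"
proof -
  have "el_t \<otimes>\<^bsub>G_ex\<^esub> el_b = el_t \<otimes>\<^bsub>G_ex\<^esub> (el_b \<otimes>\<^bsub>G_ex\<^esub> el_t) \<otimes>\<^bsub>G_ex\<^esub> el_t"
    by (simp add: G_ex.m_assoc el_t_squared)
  also have "\<dots> = el_t \<otimes>\<^bsub>G_ex\<^esub> el_t \<otimes>\<^bsub>G_ex\<^esub> el_a \<otimes>\<^bsub>G_ex\<^esub> el_t"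
    by (simp add: G_ex.m_assoc flip: el_t_el_a)
  finally show ?thesis by (simp add: el_t_squared)
qed

lemma el_a_el_b: "el_b \<otimes>\<^bsub>G_ex\<^esub> el_a = el_a \<otimes>\<^bsub>G_ex\<^esub> el_b"
proof -
  have "pres_class G_rels [(gen_a, True), (gen_b, True), (gen_a, False), (gen_b, False)] = \<one>\<^bsub>G_ex\<^esub>"
    unfolding one_G_ex pres_class_eq_iff by (rule pres_eq.rel) (simp add: G_rels_def)
  then have "el_a \<otimes>\<^bsub>G_ex\<^esub> el_b \<otimes>\<^bsub>G_ex\<^esub> inv\<^bsub>G_ex\<^esub> el_a \<otimes>\<^bsub>G_ex\<^esub> inv\<^bsub>G_ex\<^esub> el_b = \<one>\<^bsub>G_ex\<^esub>"
    by (simp add: el_a_def el_b_def mult_G_ex flip: pres_class_inverse_letter)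
  then show ?thesis by (simp add: G_ex.inv_solve_right')
qed

text \<open>Induction carries \<open>x\<close> past one factor at a time; negative exponents follow
  on multiplying by inverses from both sides. With \<open>z = y\<close> it extends commutation to
  powers, with \<open>y\<close>, \<open>z\<close> the letters \<open>a\<close>, \<open>b\<close> it
  extends the swap by \<open>t\<close>.\<close>

lemma (in group) int_pow_intertwine:
  fixes k :: int
  assumes eq: "x \<otimes> y = z \<otimes> x" and xyz: "x \<in> carrier G" "y \<in> carrier G" "z \<in> carrier G"
  shows "x \<otimes> y [^] k = z [^] k \<otimes> x"
proof -
  have nat: "x \<otimes> y [^] n = z [^] n \<otimes> x" for n :: nat
  proof (induction n)
    case (Suc n)
    have "x \<otimes> y [^] Suc n = (x \<otimes> y [^] n) \<otimes> y" using xyz by (simp add: m_assoc)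
    also have "\<dots> = z [^] n \<otimes> (x \<otimes> y)" using xyz by (simp add: Suc m_assoc)
    also have "\<dots> = z [^] Suc n \<otimes> x" using xyz by (simp add: eq m_assoc)
    finally show ?case .
  qed (use xyz in simp)
  have neg: "x \<otimes> inv (y [^] n) = inv (z [^] n) \<otimes> x" for n :: nat
  proof -
    have "inv (z [^] n) \<otimes> x = inv (z [^] n) \<otimes> (x \<otimes> y [^] n) \<otimes> inv (y [^] n)"
      using xyz by (simp add: m_assoc)
    also have "\<dots> = x \<otimes> inv (y [^] n)"
      using xyz by (simp add: nat m_assoc[symmetric])
    finally show ?thesis ..
  qed
  show ?thesis unfolding int_pow_def2 by (simp only: nat neg split: if_split) blast
qed

text \<open>The normal form \<open>a^m b^n t^e\<close>, which serves as the left inverse of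
  \<open>coords\<close>.\<close>

definition of_coords :: "(int \<times> int) \<times> int \<Rightarrow> gen gword set" where
  "of_coords = (\<lambda>((m, n), e). el_a [^]\<^bsub>G_ex\<^esub> m \<otimes>\<^bsub>G_ex\<^esub> el_b [^]\<^bsub>G_ex\<^esub> n \<otimes>\<^bsub>G_ex\<^esub>
     (if e = 0 then \<one>\<^bsub>G_ex\<^esub> else el_t))"

text \<open>The relations alone bring a letter times a normal form back to normal form:
  \<open>a\<close> is absorbed at once, \<open>b\<close> first passes the power of \<open>a\<close>,
  and \<open>t\<close> passes both powers while exchanging them.\<close>

lemma of_coords_letter_mult:
  assumes "x \<in> carrier S_ex"
  shows "pres_class G_rels [p] \<otimes>\<^bsub>G_ex\<^esub> of_coords x = of_coords (letter_val p \<otimes>\<^bsub>S_ex\<^esub> x)"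
proof -
  obtain m n e where x: "x = ((m, n), e)" and e: "e = 0 \<or> e = 1"
    using assms by (auto simp: carrier_S_ex)
  define T where "T f = (if f = 0 then \<one>\<^bsub>G_ex\<^esub> else el_t)" for f :: int
  have [simp]: "T f \<in> carrier G_ex" for f by (simp add: T_def)
  have oc: "of_coords ((i, j), f) = el_a [^]\<^bsub>G_ex\<^esub> i \<otimes>\<^bsub>G_ex\<^esub> el_b [^]\<^bsub>G_ex\<^esub> j \<otimes>\<^bsub>G_ex\<^esub> T f" for i j f
    by (simp add: of_coords_def T_def)
  have e_mod: "e mod 2 = e" using e by auto
  have T_t: "T ((1 + e) mod 2) = el_t \<otimes>\<^bsub>G_ex\<^esub> T e"
    using e by (auto simp: T_def el_t_squared)
  obtain g s where p: "p = (g, s)" by fastforce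
  define k :: int where "k = (if s then 1 else -1)"
  show ?thesis
  proof (cases g)
    case gen_a
    have "pres_class G_rels [p] = el_a [^]\<^bsub>G_ex\<^esub> k"
      by (simp add: p gen_a k_def el_a_def pres_class_inverse_letter G_ex.int_pow_neg
        carrier_G_ex)
    moreover have "letter_val p \<otimes>\<^bsub>S_ex\<^esub> x = ((k + m, n), e)"
      by (simp add: x p gen_a k_def mult_S_ex e_mod)
    ultimately show ?thesis by (simp add: x oc G_ex.int_pow_mult G_ex.m_assoc)
  next
    case gen_b
    have "pres_class G_rels [p] = el_b [^]\<^bsub>G_ex\<^esub> k"
      by (simp add: p gen_b k_def el_b_def pres_class_inverse_letter G_ex.int_pow_neg
        carrier_G_ex)
    moreover have "el_a \<otimes>\<^bsub>G_ex\<^esub> el_b [^]\<^bsub>G_ex\<^esub> k = el_b [^]\<^bsub>G_ex\<^esub> k \<otimes>\<^bsub>G_ex\<^esub> el_a"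
      by (rule G_ex.int_pow_intertwine) (simp_all add: el_a_el_b)
    \<comment> \<open>Second use of the intertwining rule: the power of \<open>el_b\<close> now
      plays the role of \<open>x\<close>, and \<open>el_a\<close> is the element raised to a
      power.\<close>
    then have "el_b [^]\<^bsub>G_ex\<^esub> k \<otimes>\<^bsub>G_ex\<^esub> el_a [^]\<^bsub>G_ex\<^esub> m =
        el_a [^]\<^bsub>G_ex\<^esub> m \<otimes>\<^bsub>G_ex\<^esub> el_b [^]\<^bsub>G_ex\<^esub> k"
      by (rule G_ex.int_pow_intertwine[OF HOL.sym]) simp_all
    then have "el_b [^]\<^bsub>G_ex\<^esub> k \<otimes>\<^bsub>G_ex\<^esub>
          (el_a [^]\<^bsub>G_ex\<^esub> m \<otimes>\<^bsub>G_ex\<^esub> el_b [^]\<^bsub>G_ex\<^esub> n \<otimes>\<^bsub>G_ex\<^esub> T e) =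
        el_a [^]\<^bsub>G_ex\<^esub> m \<otimes>\<^bsub>G_ex\<^esub> (el_b [^]\<^bsub>G_ex\<^esub> k \<otimes>\<^bsub>G_ex\<^esub> el_b [^]\<^bsub>G_ex\<^esub> n) \<otimes>\<^bsub>G_ex\<^esub> T e"
      by (simp add: G_ex.m_assoc[symmetric])
    moreover have "letter_val p \<otimes>\<^bsub>S_ex\<^esub> x = ((m, k + n), e)"
      by (simp add: x p gen_b k_def mult_S_ex e_mod)
    ultimately show ?thesis by (simp add: x oc G_ex.int_pow_mult)
  next
    case gen_t
    have "inv\<^bsub>G_ex\<^esub> el_t = el_t"
      by (rule G_ex.inv_equality) (simp_all add: el_t_squared)
    then have t: "pres_class G_rels [p] = el_t"
      by (cases s) (simp_all add: p gen_t el_t_def pres_class_inverse_letter)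
    have ta: "el_t \<otimes>\<^bsub>G_ex\<^esub> el_a [^]\<^bsub>G_ex\<^esub> m = el_b [^]\<^bsub>G_ex\<^esub> m \<otimes>\<^bsub>G_ex\<^esub> el_t"
      by (rule G_ex.int_pow_intertwine) (simp_all add: el_t_el_a)
    have tb: "el_t \<otimes>\<^bsub>G_ex\<^esub> el_b [^]\<^bsub>G_ex\<^esub> n = el_a [^]\<^bsub>G_ex\<^esub> n \<otimes>\<^bsub>G_ex\<^esub> el_t"
      by (rule G_ex.int_pow_intertwine) (simp_all add: el_t_el_b)
    have "el_a \<otimes>\<^bsub>G_ex\<^esub> el_b [^]\<^bsub>G_ex\<^esub> m = el_b [^]\<^bsub>G_ex\<^esub> m \<otimes>\<^bsub>G_ex\<^esub> el_a"
      by (rule G_ex.int_pow_intertwine) (simp_all add: el_a_el_b)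
    then have ba: "el_b [^]\<^bsub>G_ex\<^esub> m \<otimes>\<^bsub>G_ex\<^esub> el_a [^]\<^bsub>G_ex\<^esub> n = el_a [^]\<^bsub>G_ex\<^esub> n \<otimes>\<^bsub>G_ex\<^esub> el_b [^]\<^bsub>G_ex\<^esub> m"
      by (rule G_ex.int_pow_intertwine[OF HOL.sym]) simp_all
    \<comment> \<open>Each crossing of \<open>t\<close> turns one letter into the other;
      \<open>ba\<close> then restores the order with the power of \<open>a\<close> in front.\<close>
    have "el_t \<otimes>\<^bsub>G_ex\<^esub> (el_a [^]\<^bsub>G_ex\<^esub> m \<otimes>\<^bsub>G_ex\<^esub> el_b [^]\<^bsub>G_ex\<^esub> n \<otimes>\<^bsub>G_ex\<^esub> T e) =
        (el_t \<otimes>\<^bsub>G_ex\<^esub> el_a [^]\<^bsub>G_ex\<^esub> m) \<otimes>\<^bsub>G_ex\<^esub> el_b [^]\<^bsub>G_ex\<^esub> n \<otimes>\<^bsub>G_ex\<^esub> T e"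
      by (simp add: G_ex.m_assoc)
    also have "\<dots> = el_b [^]\<^bsub>G_ex\<^esub> m \<otimes>\<^bsub>G_ex\<^esub> (el_t \<otimes>\<^bsub>G_ex\<^esub> el_b [^]\<^bsub>G_ex\<^esub> n) \<otimes>\<^bsub>G_ex\<^esub> T e"
      by (simp add: ta G_ex.m_assoc)
    also have "\<dots> = (el_b [^]\<^bsub>G_ex\<^esub> m \<otimes>\<^bsub>G_ex\<^esub> el_a [^]\<^bsub>G_ex\<^esub> n) \<otimes>\<^bsub>G_ex\<^esub> (el_t \<otimes>\<^bsub>G_ex\<^esub> T e)"
      by (simp add: tb G_ex.m_assoc)
    finally have "el_t \<otimes>\<^bsub>G_ex\<^esub> (el_a [^]\<^bsub>G_ex\<^esub> m \<otimes>\<^bsub>G_ex\<^esub> el_b [^]\<^bsub>G_ex\<^esub> n \<otimes>\<^bsub>G_ex\<^esub> T e) =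
        el_a [^]\<^bsub>G_ex\<^esub> n \<otimes>\<^bsub>G_ex\<^esub> el_b [^]\<^bsub>G_ex\<^esub> m \<otimes>\<^bsub>G_ex\<^esub> (el_t \<otimes>\<^bsub>G_ex\<^esub> T e)"
      by (simp only: ba)
    moreover have "letter_val p \<otimes>\<^bsub>S_ex\<^esub> x = ((n, m), (1 + e) mod 2)"
      by (simp add: x p gen_t mult_S_ex)
    ultimately show ?thesis by (simp add: x oc t T_t)
  qed
qed

text \<open>Induction on the word, one letter at a time. A class is thus recovered from its value,
  so every equation valid in the semidirect product already follows from the presentation.\<close>

lemma of_coords_gword_val: "of_coords (gword_val u) = pres_class G_rels u"
proof (induction u)
  case Nil
  show ?case by (simp add: gword_val_Nil one_S_ex of_coords_def one_G_ex[symmetric])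
next
  case (Cons p u)
  have "pres_class G_rels (p # u) = pres_class G_rels [p] \<otimes>\<^bsub>G_ex\<^esub> pres_class G_rels u"
    by (simp add: mult_G_ex)
  then show ?case
    by (simp add: gword_val_Cons of_coords_letter_mult gword_val_carrier flip: Cons)
qed

section \<open>Injectivity of the coordinates, inverses and the five letters\<close>

lemma of_coords_coords: "g \<in> carrier G_ex \<Longrightarrow> of_coords (coords g) = g"
  by (auto simp: carrier_G_ex coords_pres_class of_coords_gword_val)

lemma coords_eq_iff:
  "g \<in> carrier G_ex \<Longrightarrow> h \<in> carrier G_ex \<Longrightarrow> coords g = coords h \<longleftrightarrow> g = h"
  by (metis of_coords_coords)

lemma coords_inv:
  assumes g: "g \<in> carrier G_ex" and c: "coords g = ((m, n), e)"
  shows "coords (inv\<^bsub>G_ex\<^esub> g) = (if e = 0 then ((- m, - n), 0) else ((- n, - m), 1))"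
proof -
  obtain m' n' e' where c': "coords (inv\<^bsub>G_ex\<^esub> g) = ((m', n'), e')" by (metis prod.exhaust)
  have "((m, n), e) \<otimes>\<^bsub>S_ex\<^esub> ((m', n'), e') = ((0, 0), 0)"
    using coords_mult[OF g G_ex.inv_closed[OF g]] g by (simp add: coords_one c c')
  moreover have "e \<in> {0, 1}" "e' \<in> {0, 1}"
    using coords_carrier[OF g] coords_carrier[of "inv\<^bsub>G_ex\<^esub> g"] g c c'
    by (auto simp: carrier_S_ex)
  ultimately show ?thesis by (auto simp: c' mult_S_ex)
qed

lemma coords_el [simp]:
  "coords el_a = ((1, 0), 0)" "coords (inv\<^bsub>G_ex\<^esub> el_a) = ((-1, 0), 0)"
  "coords el_b = ((0, 1), 0)" "coords (inv\<^bsub>G_ex\<^esub> el_b) = ((0, -1), 0)"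
  "coords el_t = ((0, 0), 1)"
proof -
  show a: "coords el_a = ((1, 0), 0)" and b: "coords el_b = ((0, 1), 0)"
    and "coords el_t = ((0, 0), 1)"
    by (simp_all add: el_a_def el_b_def el_t_def coords_pres_class gword_val_Cons gword_val_Nil
      one_S_ex mult_S_ex)
  show "coords (inv\<^bsub>G_ex\<^esub> el_a) = ((-1, 0), 0)" "coords (inv\<^bsub>G_ex\<^esub> el_b) = ((0, -1), 0)"
    using coords_inv[OF _ a] coords_inv[OF _ b] by simp_all
qed

lemma el_distinct [simp]:
  "el_a \<noteq> inv\<^bsub>G_ex\<^esub> el_a" "el_a \<noteq> el_b" "el_a \<noteq> inv\<^bsub>G_ex\<^esub> el_b" "el_a \<noteq> el_t"
  "inv\<^bsub>G_ex\<^esub> el_a \<noteq> el_b" "inv\<^bsub>G_ex\<^esub> el_a \<noteq> inv\<^bsub>G_ex\<^esub> el_b" "inv\<^bsub>G_ex\<^esub> el_a \<noteq> el_t"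
  "el_b \<noteq> inv\<^bsub>G_ex\<^esub> el_b" "el_b \<noteq> el_t" "inv\<^bsub>G_ex\<^esub> el_b \<noteq> el_t"
  by (simp_all flip: coords_eq_iff)

lemma Z_ex_closed: "z \<in> Z_ex \<Longrightarrow> z \<in> carrier G_ex"
  by (auto simp: Z_ex_def)

section \<open>Word length\<close>

lemma word_val_Nil: "word_val G [] = \<one>\<^bsub>G\<^esub>"
  and word_val_Cons: "word_val G (z # w) = z \<otimes>\<^bsub>G\<^esub> word_val G w"
  by (simp_all add: word_val_def)

lemma word_val_closed: "w \<in> lists Z_ex \<Longrightarrow> word_val G_ex w \<in> carrier G_ex"
  by (induction w) (auto simp: word_val_Nil word_val_Cons Z_ex_closed)

lemma coords_word_val_Cons:
  "z \<in> Z_ex \<Longrightarrow> w \<in> lists Z_ex \<Longrightarrow>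
     coords (word_val G_ex (z # w)) = coords z \<otimes>\<^bsub>S_ex\<^esub> coords (word_val G_ex w)"
  by (simp add: word_val_Cons coords_mult Z_ex_closed word_val_closed)

lemma coords_word_val_replicate:
  assumes "z \<in> Z_ex" "w \<in> lists Z_ex" "coords z = ((i, j), 0)"
    "coords (word_val G_ex w) = ((m, n), e)"
  shows "coords (word_val G_ex (replicate k z @ w)) = ((int k * i + m, int k * j + n), e)"
proof -
  have e: "e = 0 \<or> e = 1"
    using coords_carrier[OF word_val_closed[OF assms(2)]] assms(4) by (simp add: carrier_S_ex)
  have "replicate k z \<in> lists Z_ex" for k using assms(1) by (induction k) auto
  then show ?thesis
  proof (induction k)
    case (Suc k)
    then have "coords (word_val G_ex (z # (replicate k z @ w))) =
        coords z \<otimes>\<^bsub>S_ex\<^esub> coords (word_val G_ex (replicate k z @ w))"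
      using assms by (intro coords_word_val_Cons) auto
    then show ?case using Suc assms e
      by (auto simp: mult_S_ex algebra_simps)
  qed (use assms in simp)
qed

text \<open>This is the word length over \<open>Z_ex\<close>: \<open>exists_word\<close> attains it
  and \<open>coord_length_le\<close> bounds it from above by the length of any word.\<close>

definition coord_length :: "(int \<times> int) \<times> int \<Rightarrow> int" where
  "coord_length = (\<lambda>((m, n), e). \<bar>m\<bar> + \<bar>n\<bar> + e)"

lemma exists_word:
  assumes "x \<in> carrier S_ex"
  obtains w where "w \<in> lists Z_ex" "coords (word_val G_ex w) = x" "int (length w) = coord_length x"
proof -
  obtain m n e where x: "x = ((m, n), e)" and e: "e = 0 \<or> e = 1"
    using assms by (auto simp: carrier_S_ex)
  \<comment> \<open>The word built is the normal form, the signs of \<open>m\<close> and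
    \<open>n\<close> deciding between a letter and its inverse.\<close>
  define v where "v = (if e = 0 then [] else [el_t])"
  define z where "z = (if n \<ge> 0 then el_b else inv\<^bsub>G_ex\<^esub> el_b)"
  define y where "y = (if m \<ge> 0 then el_a else inv\<^bsub>G_ex\<^esub> el_a)"
  let ?w = "replicate (nat \<bar>n\<bar>) z @ v"
  have Z: "y \<in> Z_ex" "z \<in> Z_ex" by (simp_all add: y_def z_def Z_ex_def)
  have v: "v \<in> lists Z_ex" by (simp add: v_def Z_ex_def)
  then have w: "?w \<in> lists Z_ex" using Z by auto
  have "coords (word_val G_ex v) = ((0, 0), e)"
    using e by (auto simp: v_def word_val_Nil word_val_Cons coords_one)
  from coords_word_val_replicate[OF Z(2) v _ this, of 0 "if n \<ge> 0 then 1 else -1" "nat \<bar>n\<bar>"]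
  have "coords (word_val G_ex ?w) = ((0, n), e)"
    by (simp add: z_def split: if_splits)
  from coords_word_val_replicate[OF Z(1) w _ this, of "if m \<ge> 0 then 1 else -1" 0 "nat \<bar>m\<bar>"]
  have "coords (word_val G_ex (replicate (nat \<bar>m\<bar>) y @ ?w)) = x"
    by (simp add: y_def x split: if_splits)
  moreover have "replicate (nat \<bar>m\<bar>) y @ ?w \<in> lists Z_ex" using Z w by auto
  moreover have "int (length (replicate (nat \<bar>m\<bar>) y @ ?w)) = coord_length x"
    using e by (auto simp: x coord_length_def v_def)
  ultimately show thesis using that by blast
qed

text \<open>Prepending \<open>t\<close> exchanges \<open>m\<close> and \<open>n\<close>, so the
  counts do not determine the exponents in general. The sum \<open>m + n\<close> and the bound on
  \<open>\<bar>m\<bar> + \<bar>n\<bar>\<close> survive the exchange; the exponents themselves are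
  recovered when no \<open>t\<close> occurs.\<close>

lemma coords_word_val_counts:
  assumes "w \<in> lists Z_ex"
  defines "p \<equiv> int (count_list w el_a)" and "q \<equiv> int (count_list w (inv\<^bsub>G_ex\<^esub> el_a))"
    and "r \<equiv> int (count_list w el_b)" and "s \<equiv> int (count_list w (inv\<^bsub>G_ex\<^esub> el_b))"
    and "k \<equiv> int (count_list w el_t)"
  assumes "coords (word_val G_ex w) = ((m, n), e)"
  shows "int (length w) = p + q + r + s + k \<and> m + n = p - q + r - s \<and>
    \<bar>m\<bar> + \<bar>n\<bar> \<le> p + q + r + s \<and> e = k mod 2 \<and> (k = 0 \<longrightarrow> m = p - q \<and> n = r - s)"
  using assms(1,7) unfolding p_def q_def r_def s_def k_def
proof (induction w arbitrary: m n e rule: list.induct)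
  case Nil
  then show ?case by (simp add: word_val_Nil coords_one)
next
  case (Cons z w)
  obtain m' n' e' where c: "coords (word_val G_ex w) = ((m', n'), e')" by (metis prod.exhaust)
  have "z \<in> Z_ex" "w \<in> lists Z_ex" using Cons.prems by auto
  note IH = Cons.IH[OF this(2) c]
  have eq: "coords z \<otimes>\<^bsub>S_ex\<^esub> ((m', n'), e') = ((m, n), e)"
    using coords_word_val_Cons[OF \<open>z \<in> Z_ex\<close> \<open>w \<in> lists Z_ex\<close>] Cons.prems c by simp
  from \<open>z \<in> Z_ex\<close> consider "z = el_a" | "z = inv\<^bsub>G_ex\<^esub> el_a" | "z = el_b" | "z = inv\<^bsub>G_ex\<^esub> el_b"
    | "z = el_t" by (auto simp: Z_ex_def)
  then show ?case
  proof cases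
    case 1
    then show ?thesis using IH eq by (auto simp: mult_S_ex el_distinct[symmetric])
  next
    case 2
    then show ?thesis using IH eq by (auto simp: mult_S_ex el_distinct[symmetric])
  next
    case 3
    then show ?thesis using IH eq by (auto simp: mult_S_ex el_distinct[symmetric])
  next
    case 4
    then show ?thesis using IH eq by (auto simp: mult_S_ex el_distinct[symmetric])
  next
    case 5
    then show ?thesis using IH eq by (auto simp: mult_S_ex el_distinct[symmetric] mod_simps)
  qed
qed

lemma coord_length_le:
  assumes "w \<in> lists Z_ex"
  shows "coord_length (coords (word_val G_ex w)) \<le> int (length w)"
proof -
  obtain m n e where c: "coords (word_val G_ex w) = ((m, n), e)" by (metis prod.exhaust)
  \<comment> \<open>The letter \<open>t\<close> contributes its full count to the length, but only
    the parity of that count to the coordinates.\<close>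
  have "int k mod 2 \<le> int k" for k by (simp add: zmod_le_nonneg_dividend)
  with coords_word_val_counts[OF assms c] show ?thesis
    unfolding coord_length_def c by (auto intro!: add_mono)
qed

lemma Geo_iff:
  "w \<in> Geo G_ex Z_ex \<longleftrightarrow>
     w \<in> lists Z_ex \<and> int (length w) = coord_length (coords (word_val G_ex w))"
proof
  assume w: "w \<in> Geo G_ex Z_ex"
  then have l: "w \<in> lists Z_ex" by (simp add: Geo_def)
  obtain u where u: "u \<in> lists Z_ex" "coords (word_val G_ex u) = coords (word_val G_ex w)"
      "int (length u) = coord_length (coords (word_val G_ex w))"
    using exists_word[OF coords_carrier[OF word_val_closed[OF l]]] .
  then have "word_val G_ex u = word_val G_ex w"
    using l by (simp add: coords_eq_iff word_val_closed)
  with w u have "length w \<le> length u" by (auto simp: Geo_def)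
  with u coord_length_le[OF l] l
  show "w \<in> lists Z_ex \<and> int (length w) = coord_length (coords (word_val G_ex w))" by simp
next
  assume w: "w \<in> lists Z_ex \<and> int (length w) = coord_length (coords (word_val G_ex w))"
  have "length w \<le> length u" if "u \<in> lists Z_ex" "word_val G_ex u = word_val G_ex w" for u
    using coord_length_le[OF that(1)] that(2) w by simp
  with w show "w \<in> Geo G_ex Z_ex" by (simp add: Geo_def)
qed

section \<open>Conjugacy geodesics\<close>

lemma conj_classE:
  assumes "h \<in> conj_class G g"
  obtains x where "x \<in> carrier G" "h = x \<otimes>\<^bsub>G\<^esub> g \<otimes>\<^bsub>G\<^esub> inv\<^bsub>G\<^esub> x"
  using assms by (auto simp: conj_class_def)

lemma (in group) conj_class_conj:
  assumes "x \<in> carrier G" "g \<in> carrier G"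
  shows "conj_class G (x \<otimes> g \<otimes> inv x) = conj_class G g"
proof
  show "conj_class G (x \<otimes> g \<otimes> inv x) \<subseteq> conj_class G g"
  proof
    fix h assume "h \<in> conj_class G (x \<otimes> g \<otimes> inv x)"
    then obtain y where y: "y \<in> carrier G" "h = y \<otimes> (x \<otimes> g \<otimes> inv x) \<otimes> inv y"
      by (auto simp: conj_class_def)
    then have "h = (y \<otimes> x) \<otimes> g \<otimes> inv (y \<otimes> x)"
      using assms by (simp add: m_assoc inv_mult_group)
    then show "h \<in> conj_class G g" using y assms by (auto simp: conj_class_def)
  qed
  show "conj_class G g \<subseteq> conj_class G (x \<otimes> g \<otimes> inv x)"
  proof
    fix h assume "h \<in> conj_class G g"
    then obtain y where y: "y \<in> carrier G" "h = y \<otimes> g \<otimes> inv y"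
      by (auto simp: conj_class_def)
    have "inv x \<otimes> (x \<otimes> z) = z" if "z \<in> carrier G" for z
      using that assms by (simp add: m_assoc[symmetric])
    then have "h = (y \<otimes> inv x) \<otimes> (x \<otimes> g \<otimes> inv x) \<otimes> inv (y \<otimes> inv x)"
      using y assms by (simp add: m_assoc inv_mult_group)
    then show "h \<in> conj_class G (x \<otimes> g \<otimes> inv x)" using y assms by (auto simp: conj_class_def)
  qed
qed

lemma (in group) self_in_conj_class: "g \<in> carrier G \<Longrightarrow> g \<in> conj_class G g"
  by (auto simp: conj_class_def intro!: exI[of _ \<one>])

text \<open>Direct computation. For \<open>e = 1\<close> the same amount is added to one exponent
  and subtracted from the other, so \<open>m + n\<close> is invariant.\<close>

lemma coords_conj:
  assumes x: "x \<in> carrier G_ex" "coords x = ((p, q), f)"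
    and g: "g \<in> carrier G_ex" "coords g = ((m, n), e)"
  shows "coords (x \<otimes>\<^bsub>G_ex\<^esub> g \<otimes>\<^bsub>G_ex\<^esub> inv\<^bsub>G_ex\<^esub> x) =
    (if e = 0 then (if f = 0 then ((m, n), 0) else ((n, m), 0))
     else if f = 0 then ((m + p - q, n + q - p), 1) else ((n + p - q, m + q - p), 1))"
proof -
  have "e \<in> {0, 1}" "f \<in> {0, 1}"
    using coords_carrier[OF x(1)] coords_carrier[OF g(1)] x g by (auto simp: carrier_S_ex)
  then show ?thesis
    using x g by (auto simp: coords_mult coords_inv[OF x] mult_S_ex)
qed

text \<open>The shortest length in the conjugacy class: it is a class invariant by
  \<open>conj_length_conj\<close>, at most the word length by \<open>conj_length_le\<close>, and
  attained by \<open>exists_short_conj\<close>.\<close>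

definition conj_length :: "(int \<times> int) \<times> int \<Rightarrow> int" where
  "conj_length = (\<lambda>((m, n), e). if e = 0 then \<bar>m\<bar> + \<bar>n\<bar> else \<bar>m + n\<bar> + 1)"

lemma conj_length_le: "x \<in> carrier S_ex \<Longrightarrow> conj_length x \<le> coord_length x"
  by (auto simp: carrier_S_ex conj_length_def coord_length_def)

lemma conj_length_conj:
  assumes "g \<in> carrier G_ex" "h \<in> conj_class G_ex g"
  shows "conj_length (coords h) = conj_length (coords g)"
proof -
  obtain x where x: "x \<in> carrier G_ex" "h = x \<otimes>\<^bsub>G_ex\<^esub> g \<otimes>\<^bsub>G_ex\<^esub> inv\<^bsub>G_ex\<^esub> x"
    using assms(2) by (rule conj_classE)
  obtain p q f m n e where "coords x = ((p, q), f)" and g: "coords g = ((m, n), e)"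
    by (metis prod.exhaust)
  from coords_conj[OF x(1) this(1) assms(1) g] show ?thesis
    unfolding x(2) g conj_length_def by (simp add: add.commute)
qed

lemma exists_short_conj:
  assumes g: "g \<in> carrier G_ex"
  obtains u where "u \<in> lists Z_ex" "conj_class G_ex (word_val G_ex u) = conj_class G_ex g"
    "int (length u) = conj_length (coords g)"
proof -
  obtain m n e where c: "coords g = ((m, n), e)" by (metis prod.exhaust)
  have e: "e = 0 \<or> e = 1" using coords_carrier[OF g] by (simp add: c carrier_S_ex)
  \<comment> \<open>Conjugating \<open>a\<^sup>m b\<^sup>n t\<close> by \<open>a\<^sup>n\<close> gives \<open>a\<^sup>m\<^sup>+\<^sup>n t\<close>.\<close>
  obtain v where v: "v \<in> lists Z_ex" "coords (word_val G_ex v) = ((if e = 0 then 0 else n, 0), 0)"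
    using exists_word[of "((if e = 0 then 0 else n, 0), 0)"] by (auto simp: carrier_S_ex)
  let ?x = "word_val G_ex v"
  let ?h = "?x \<otimes>\<^bsub>G_ex\<^esub> g \<otimes>\<^bsub>G_ex\<^esub> inv\<^bsub>G_ex\<^esub> ?x"
  have x: "?x \<in> carrier G_ex" using v(1) by (rule word_val_closed)
  then have h: "?h \<in> carrier G_ex" using g by simp
  have "coord_length (coords ?h) = conj_length (coords g)"
    using e by (auto simp: coords_conj[OF x v(2) g c] c coord_length_def conj_length_def)
  moreover obtain u where u: "u \<in> lists Z_ex" "coords (word_val G_ex u) = coords ?h"
      "int (length u) = coord_length (coords ?h)"
    using exists_word[OF coords_carrier[OF h]] .
  moreover have "word_val G_ex u = ?h" using u h by (simp only: coords_eq_iff word_val_closed)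
  ultimately show thesis using that[of u] G_ex.conj_class_conj[OF x g] by simp
qed

text \<open>Since \<open>conj_length\<close> is at most \<open>coord_length\<close>, which is at
  most the length of the word, equality of the outer terms also forces the word to be
  geodesic.\<close>

lemma ConjGeo_iff:
  "w \<in> ConjGeo G_ex Z_ex \<longleftrightarrow>
     w \<in> lists Z_ex \<and> int (length w) = conj_length (coords (word_val G_ex w))"
proof
  assume w: "w \<in> ConjGeo G_ex Z_ex"
  then have l: "w \<in> lists Z_ex" and
      len: "int (length w) = coord_length (coords (word_val G_ex w))"
    by (auto simp: ConjGeo_def Geo_iff)
  note cl = word_val_closed[OF l]
  obtain u where u: "u \<in> lists Z_ex"
      "conj_class G_ex (word_val G_ex u) = conj_class G_ex (word_val G_ex w)"
      "int (length u) = conj_length (coords (word_val G_ex w))"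
    using exists_short_conj[OF cl] .
  with w have "length w \<le> length u" by (auto simp: ConjGeo_def)
  with u l len conj_length_le[OF coords_carrier[OF cl]]
  show "w \<in> lists Z_ex \<and> int (length w) = conj_length (coords (word_val G_ex w))" by simp
next
  assume w: "w \<in> lists Z_ex \<and> int (length w) = conj_length (coords (word_val G_ex w))"
  then have cl: "word_val G_ex w \<in> carrier G_ex" by (simp add: word_val_closed)
  have le: "conj_length (coords (word_val G_ex u)) \<le> int (length u)" if "u \<in> lists Z_ex" for u
    using conj_length_le[OF coords_carrier[OF word_val_closed[OF that]]] coord_length_le[OF that]
    by simp
  have "length w \<le> length u"
    if u: "u \<in> lists Z_ex" and
      eq: "conj_class G_ex (word_val G_ex w) = conj_class G_ex (word_val G_ex u)" for u
  proof -
    have "word_val G_ex w \<in> conj_class G_ex (word_val G_ex u)"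
      using G_ex.self_in_conj_class[OF cl] eq by simp
    then have "conj_length (coords (word_val G_ex w)) = conj_length (coords (word_val G_ex u))"
      using u by (intro conj_length_conj word_val_closed)
    then show ?thesis using w le[OF u] by simp
  qed
  moreover have "w \<in> Geo G_ex Z_ex"
    using w conj_length_le[OF coords_carrier[OF cl]] coord_length_le[of w] by (simp add: Geo_iff)
  ultimately show "w \<in> ConjGeo G_ex Z_ex" by (simp add: ConjGeo_def)
qed

text \<open>In terms of counts, \<open>\<bar>p - q\<bar> + \<bar>r - s\<bar>\<close> equals
  \<open>p + q + r + s\<close> iff neither difference cancels, and
  \<open>\<bar>p - q + r - s\<bar>\<close> equals it iff all signs agree.\<close>

lemma ConjGeo_letters:
  "w \<in> ConjGeo G_ex Z_ex \<longleftrightarrow> w \<in> lists Z_ex \<and>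
     (count_list w el_t = 0 \<and> (el_a \<notin> set w \<or> inv\<^bsub>G_ex\<^esub> el_a \<notin> set w) \<and>
        (el_b \<notin> set w \<or> inv\<^bsub>G_ex\<^esub> el_b \<notin> set w) \<or>
      count_list w el_t = 1 \<and> ({el_a, el_b} \<inter> set w = {} \<or>
        {inv\<^bsub>G_ex\<^esub> el_a, inv\<^bsub>G_ex\<^esub> el_b} \<inter> set w = {}))"
proof (cases "w \<in> lists Z_ex")
  case True
  obtain m n e where c: "coords (word_val G_ex w) = ((m, n), e)" by (metis prod.exhaust)
  define p q r s k where "p = count_list w el_a" and "q = count_list w (inv\<^bsub>G_ex\<^esub> el_a)"
    and "r = count_list w el_b" and "s = count_list w (inv\<^bsub>G_ex\<^esub> el_b)"
    and "k = count_list w el_t"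
  note counts = coords_word_val_counts[OF True c, folded p_def q_def r_def s_def k_def]
  have zero: "el_a \<notin> set w \<longleftrightarrow> p = 0" "inv\<^bsub>G_ex\<^esub> el_a \<notin> set w \<longleftrightarrow> q = 0"
      "el_b \<notin> set w \<longleftrightarrow> r = 0" "inv\<^bsub>G_ex\<^esub> el_b \<notin> set w \<longleftrightarrow> s = 0"
    by (simp_all add: p_def q_def r_def s_def count_list_0_iff)
  consider "k = 0" | "k = 1" | "k \<ge> 2" by linarith
  then have "int (length w) = conj_length ((m, n), e) \<longleftrightarrow>
      k = 0 \<and> (p = 0 \<or> q = 0) \<and> (r = 0 \<or> s = 0) \<or>
      k = 1 \<and> (p = 0 \<and> r = 0 \<or> q = 0 \<and> s = 0)"
  proof cases
    case 1
    with counts show ?thesis by (auto simp: conj_length_def)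
  next
    case 2
    with counts show ?thesis by (auto simp: conj_length_def)
  next
    case 3
    \<comment> \<open>The length is at least \<open>\<bar>m\<bar> + \<bar>n\<bar> + 2\<close>, which
      exceeds both possible values of \<open>conj_length\<close>.\<close>
    then have "conj_length ((m, n), e) < int (length w)"
      using counts abs_triangle_ineq[of m n] by (auto simp: conj_length_def)
    with 3 show ?thesis by auto
  qed
  with True show ?thesis by (auto simp: ConjGeo_iff c zero simp flip: k_def)
qed (simp add: ConjGeo_iff)

section \<open>Regular languages\<close>

text \<open>Allows automata with states of any type: an injection of the finite state set into the
  naturals transports the transitions.\<close>

lemma regular_language_foldl:
  fixes Q :: "'s set"
  assumes Q: "finite Q" and q0: "q0 \<in> Q" and \<delta>: "\<And>q z. q \<in> Q \<Longrightarrow> z \<in> Z \<Longrightarrow> \<delta> q z \<in> Q"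
  shows "regular_language Z {w \<in> lists Z. foldl \<delta> q0 w \<in> F}"
proof -
  obtain f :: "'s \<Rightarrow> nat" where f: "inj_on f Q"
    using finite_imp_inj_to_nat_seg[OF Q] by blast
  define \<delta>' where "\<delta>' n z = f (\<delta> (inv_into Q f n) z)" for n z
  have step: "\<delta>' (f q) z = f (\<delta> q z)" if "q \<in> Q" for q z
    using f that by (simp add: \<delta>'_def)
  have run: "foldl \<delta>' (f q) w = f (foldl \<delta> q w) \<and> foldl \<delta> q w \<in> Q"
    if "q \<in> Q" "w \<in> lists Z" for q w
    using that(2,1)
    by (induction w arbitrary: q) (auto simp: step \<delta>)
  \<comment> \<open>The accepting set is cut down to \<open>Q\<close> because \<open>f\<close> is
    injective only there.\<close>
  have "foldl \<delta>' (f q0) w \<in> f ` (F \<inter> Q) \<longleftrightarrow> foldl \<delta> q0 w \<in> F" if "w \<in> lists Z" for w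
    using run[OF q0 that] f by (auto simp: inj_on_image_mem_iff[of f Q _ "F \<inter> Q"])
  then have "{w \<in> lists Z. foldl \<delta> q0 w \<in> F} = {w \<in> lists Z. foldl \<delta>' (f q0) w \<in> f ` (F \<inter> Q)}"
    by blast
  moreover have "\<forall>n\<in>f ` Q. \<forall>z\<in>Z. \<delta>' n z \<in> f ` Q" using \<delta> by (auto simp: step)
  ultimately show ?thesis
    unfolding regular_language_def using Q q0
    by (intro exI[of _ "f ` Q"] exI[of _ "f q0"] exI[of _ \<delta>'] exI[of _ "f ` (F \<inter> Q)"]) auto
qed

text \<open>Pigeonhole: two powers of \<open>z\<close> reach the same state, and no continuation can
  then tell them apart. The bound \<open>N\<close> lets both exponents be taken large.\<close>

lemma regular_language_replicate:
  assumes "regular_language Z L" "z \<in> Z"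
  obtains i j where "N \<le> i" "i < j"
    "\<And>v. v \<in> lists Z \<Longrightarrow> replicate i z @ v \<in> L \<longleftrightarrow> replicate j z @ v \<in> L"
proof -
  obtain Q :: "nat set" and q0 \<delta> F where Q: "finite Q" "q0 \<in> Q" "\<forall>q\<in>Q. \<forall>z\<in>Z. \<delta> q z \<in> Q"
    and L: "L = {w \<in> lists Z. foldl \<delta> q0 w \<in> F}"
    using assms(1) unfolding regular_language_def by metis
  have "foldl \<delta> q (replicate n z) \<in> Q" if "q \<in> Q" for n q
    using that assms(2) Q(3) by (induction n arbitrary: q) auto
  then have "(\<lambda>n. foldl \<delta> q0 (replicate n z)) ` {N..} \<subseteq> Q" using Q(2) by auto
  then have "\<not> inj_on (\<lambda>n. foldl \<delta> q0 (replicate n z)) {N..}"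
    using Q(1) finite_subset finite_imageD infinite_Ici by blast
  then obtain i j where ij: "N \<le> i" "i < j"
      "foldl \<delta> q0 (replicate i z) = foldl \<delta> q0 (replicate j z)"
    unfolding inj_on_def by (metis atLeast_iff linorder_neqE_nat)
  have "replicate n z \<in> lists Z" for n using assms(2) by (induction n) auto
  then have "replicate i z @ v \<in> L \<longleftrightarrow> replicate j z @ v \<in> L" if "v \<in> lists Z" for v
    using that ij(3) by (simp add: L)
  with ij show thesis using that by blast
qed

lemma regular_ConjGeo: "regular_language Z_ex (ConjGeo G_ex Z_ex)"
proof -
  \<comment> \<open>States record the set of letters read and the number of \<open>t\<close>'s, capped at 2.\<close>
  define \<delta> :: "gen gword set set \<times> nat \<Rightarrow> gen gword set \<Rightarrow> gen gword set set \<times> nat"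
    where "\<delta> = (\<lambda>(Y, k) z. (insert z Y, (if z = el_t then min 2 (Suc k) else k)))"
  define F where "F = {(Y, k).
     k = 0 \<and> (el_a \<notin> Y \<or> inv\<^bsub>G_ex\<^esub> el_a \<notin> Y) \<and> (el_b \<notin> Y \<or> inv\<^bsub>G_ex\<^esub> el_b \<notin> Y) \<or>
     k = (1 :: nat) \<and> ({el_a, el_b} \<inter> Y = {} \<or> {inv\<^bsub>G_ex\<^esub> el_a, inv\<^bsub>G_ex\<^esub> el_b} \<inter> Y = {})}"
  \<comment> \<open>Stated for any starting state so that the induction goes through. The cap at 2
    preserves whether the count is 0 or 1, which is all that \<open>F\<close> tests.\<close>
  have run: "foldl \<delta> (Y, min 2 k) w = (Y \<union> set w, min 2 (k + count_list w el_t))" for Y k w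
  proof (induction w arbitrary: Y k)
    case (Cons z w)
    have "\<delta> (Y, min 2 k) z = (insert z Y, min 2 (if z = el_t then Suc k else k))"
      by (auto simp: \<delta>_def)
    then show ?case using Cons[of "insert z Y" "if z = el_t then Suc k else k"] by auto
  qed simp
  have "ConjGeo G_ex Z_ex = {w \<in> lists Z_ex. foldl \<delta> ({}, 0) w \<in> F}"
    using run[of "{}" 0] by (auto simp: ConjGeo_letters F_def)
  moreover have "regular_language Z_ex {w \<in> lists Z_ex. foldl \<delta> ({}, 0) w \<in> F}"
    by (rule regular_language_foldl[of "Pow Z_ex \<times> {..2}"]) (auto simp: \<delta>_def Z_ex_def)
  ultimately show ?thesis by simp
qed

section \<open>Uniform conjugacy geodesics\<close>

lemma coords_a_b:
  "coords (word_val G_ex (replicate i el_a @ replicate j el_b)) = ((int i, int j), 0)"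
proof -
  have Z: "el_a \<in> Z_ex" "el_b \<in> Z_ex" by (simp_all add: Z_ex_def)
  have b: "coords (word_val G_ex (replicate j el_b @ [])) = ((0, int j), 0)"
    using coords_word_val_replicate[OF Z(2), of "[]" 0 1 0 0 0 j]
    by (simp add: word_val_Nil coords_one)
  have "replicate j el_b \<in> lists Z_ex" using Z by auto
  then show ?thesis
    using coords_word_val_replicate[OF Z(1), of "replicate j el_b" 1 0 0 "int j" 0 i] b by simp
qed

lemma a_b_in_Geo: "replicate i el_a @ replicate j el_b \<in> Geo G_ex Z_ex"
proof -
  have "el_a \<in> Z_ex" "el_b \<in> Z_ex" by (simp_all add: Z_ex_def)
  then show ?thesis by (auto simp: Geo_iff coords_a_b coord_length_def)
qed

lemma noncentral_conj_class:
  assumes "g \<in> carrier G_ex" "x \<in> carrier G_ex"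
    "coords (x \<otimes>\<^bsub>G_ex\<^esub> g \<otimes>\<^bsub>G_ex\<^esub> inv\<^bsub>G_ex\<^esub> x) \<noteq> coords g"
  shows "\<exists>y\<in>conj_class G_ex g. \<exists>z\<in>conj_class G_ex g. y \<noteq> z"
proof (intro bexI)
  show "x \<otimes>\<^bsub>G_ex\<^esub> g \<otimes>\<^bsub>G_ex\<^esub> inv\<^bsub>G_ex\<^esub> x \<noteq> g" using assms(3) by metis
  show "g \<in> conj_class G_ex g" by (rule G_ex.self_in_conj_class[OF assms(1)])
  show "x \<otimes>\<^bsub>G_ex\<^esub> g \<otimes>\<^bsub>G_ex\<^esub> inv\<^bsub>G_ex\<^esub> x \<in> conj_class G_ex g"
    using assms(2) by (auto simp: conj_class_def)
qed

text \<open>Equal exponents are fixed by the swap, so the element is central and its uniform class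
  is a singleton; being geodesic suffices.\<close>

lemma a_b_in_UConjGeo: "replicate i el_a @ replicate i el_b \<in> UConjGeo G_ex Z_ex"
proof -
  let ?w = "replicate i el_a @ replicate i el_b"
  let ?g = "word_val G_ex ?w"
  have w: "?w \<in> lists Z_ex" using a_b_in_Geo[of i i] by (simp add: Geo_iff)
  have g: "?g \<in> carrier G_ex" using w by (rule word_val_closed)
  have central: "h = ?g" if h: "h \<in> conj_class G_ex ?g" for h
  proof -
    obtain x where x: "x \<in> carrier G_ex" "h = x \<otimes>\<^bsub>G_ex\<^esub> ?g \<otimes>\<^bsub>G_ex\<^esub> inv\<^bsub>G_ex\<^esub> x"
      using h by (rule conj_classE)
    obtain p q f where "coords x = ((p, q), f)" by (metis prod.exhaust)
    from coords_conj[OF x(1) this g coords_a_b] have "coords h = coords ?g"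
      by (simp add: x(2) coords_a_b)
    moreover have "h \<in> carrier G_ex" unfolding x(2) using x(1) g by blast
    ultimately show ?thesis using g by (simp only: coords_eq_iff)
  qed
  have "length ?w \<le> length u" if u: "u \<in> Geo G_ex Z_ex" "(?g, word_val G_ex u) \<in> UConj G_ex" for u
  proof -
    have "word_val G_ex u = ?g" using u(2) central unfolding UConj_def by blast
    then show ?thesis using a_b_in_Geo[of i i] u(1) unfolding Geo_def by simp
  qed
  then show ?thesis using a_b_in_Geo by (simp add: UConjGeo_def)
qed

text \<open>Both the element and \<open>t\<close> are noncentral, so the one-letter word
  \<open>t\<close> is a strictly shorter competitor.\<close>

lemma a_b_notin_UConjGeo:
  assumes "i \<noteq> j" "2 \<le> i + j"
  shows "replicate i el_a @ replicate j el_b \<notin> UConjGeo G_ex Z_ex"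
proof
  let ?w = "replicate i el_a @ replicate j el_b"
  let ?g = "word_val G_ex ?w"
  assume w: "?w \<in> UConjGeo G_ex Z_ex"
  have l: "?w \<in> lists Z_ex" using a_b_in_Geo[of i j] by (simp add: Geo_iff)
  have g: "?g \<in> carrier G_ex" using l by (rule word_val_closed)
  have t: "word_val G_ex [el_t] = el_t" by (simp add: word_val_Cons word_val_Nil)
  \<comment> \<open>Conjugation by \<open>t\<close> exchanges the different exponents
    \<open>i\<close> and \<open>j\<close>.\<close>
  have "\<exists>y\<in>conj_class G_ex ?g. \<exists>z\<in>conj_class G_ex ?g. y \<noteq> z"
    using assms(1) coords_conj[OF _ coords_el(5) g coords_a_b]
    by (intro noncentral_conj_class[OF g, of el_t]) (simp_all add: coords_a_b)
  \<comment> \<open>Conjugating \<open>t\<close> by \<open>a\<close> gives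
    \<open>a b^(-1) t\<close>, with coordinates \<open>((1, -1), 1)\<close>.\<close>
  moreover have "\<exists>y\<in>conj_class G_ex el_t. \<exists>z\<in>conj_class G_ex el_t. y \<noteq> z"
    using coords_conj[OF _ coords_el(1) _ coords_el(5)]
    by (intro noncentral_conj_class[of el_t el_a]) simp_all
  ultimately have "(?g, word_val G_ex [el_t]) \<in> UConj G_ex"
    using g by (simp add: UConj_def t)
  moreover have "[el_t] \<in> Geo G_ex Z_ex"
    by (simp add: Geo_iff t coord_length_def) (simp add: Z_ex_def)
  ultimately have "length ?w \<le> length [el_t]" using w unfolding UConjGeo_def by blast
  with assms(2) show False by simp
qed

text \<open>The continuation \<open>b^i\<close> separates \<open>a^i\<close> from
  \<open>a^j\<close>: the first product lies in the language, the second does not. Starting from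
  exponent 2 excludes short words, where \<open>t\<close> would not be shorter.\<close>

lemma not_regular_UConjGeo: "\<not> regular_language Z_ex (UConjGeo G_ex Z_ex)"
proof
  assume "regular_language Z_ex (UConjGeo G_ex Z_ex)"
  then obtain i j where ij: "2 \<le> i" "i < j" and
    eq: "\<And>v. v \<in> lists Z_ex \<Longrightarrow>
      replicate i el_a @ v \<in> UConjGeo G_ex Z_ex \<longleftrightarrow> replicate j el_a @ v \<in> UConjGeo G_ex Z_ex"
    by (rule regular_language_replicate[where z = el_a and N = 2]) (auto simp: Z_ex_def)
  have "replicate i el_b \<in> lists Z_ex" by (auto simp: Z_ex_def)
  from eq[OF this] show False
    using a_b_in_UConjGeo[of i] a_b_notin_UConjGeo[of j i] ij by simp
qed

section \<open>The group\<close>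

lemma coords_iso: "coords \<in> iso G_ex S_ex"
proof -
  have "coords \<in> hom G_ex S_ex"
    by (auto intro!: homI coords_carrier coords_mult)
  moreover have "inj_on coords (carrier G_ex)"
    by (auto intro!: inj_onI simp: coords_eq_iff)
  moreover have "carrier S_ex \<subseteq> coords ` carrier G_ex"
  proof
    fix x assume "x \<in> carrier S_ex"
    then obtain w where "w \<in> lists Z_ex" "coords (word_val G_ex w) = x" by (rule exists_word)
    then show "x \<in> coords ` carrier G_ex" using word_val_closed by blast
  qed
  ultimately show ?thesis
    by (auto simp: iso_iff coords_carrier)
qed

text \<open>The abelian subgroup is the copy of \<open>\<int> \<times> \<int>\<close> given by
  \<open>e = 0\<close>, the kernel of the projection to the group of order 2.\<close>

lemma virtually_abelian_G_ex: "virtually_abelian G_ex"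
proof -
  let ?h = "\<lambda>g. snd (coords g)"
  let ?C = "integer_mod_group 2"
  have S: "snd (x \<otimes>\<^bsub>S_ex\<^esub> y) = (snd x + snd y) mod 2" for x y
    by (cases x; cases y) (auto simp: mult_S_ex split_paired_all)
  have "?h g \<in> carrier ?C" if "g \<in> carrier G_ex" for g
    using coords_carrier[OF that] by (auto simp: carrier_integer_mod_group carrier_S_ex)
  then have "?h \<in> hom G_ex ?C"
    by (auto intro!: homI simp: coords_mult S)
  then interpret h: group_hom G_ex ?C ?h
    by (simp add: group_hom_def group_hom_axioms_def G_ex.is_group)
  let ?K = "kernel G_ex ?C ?h"
  have K: "subgroup ?K G_ex" by (rule h.subgroup_kernel)
  have "comm_group (G_ex\<lparr>carrier := ?K\<rparr>)"
  proof (rule group.group_comm_groupI)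
    show "group (G_ex\<lparr>carrier := ?K\<rparr>)" by (rule subgroup.subgroup_is_group[OF K G_ex.is_group])
    fix x y assume "x \<in> carrier (G_ex\<lparr>carrier := ?K\<rparr>)" "y \<in> carrier (G_ex\<lparr>carrier := ?K\<rparr>)"
    then have xy: "x \<in> carrier G_ex" "y \<in> carrier G_ex" "?h x = 0" "?h y = 0"
      by (simp_all add: kernel_def)
    then have "coords (x \<otimes>\<^bsub>G_ex\<^esub> y) = coords (y \<otimes>\<^bsub>G_ex\<^esub> x)"
      by (cases "coords x"; cases "coords y") (auto simp: coords_mult mult_S_ex)
    then show "x \<otimes>\<^bsub>G_ex\<lparr>carrier := ?K\<rparr>\<^esub> y = y \<otimes>\<^bsub>G_ex\<lparr>carrier := ?K\<rparr>\<^esub> x"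
      using xy by (simp add: coords_eq_iff)
  qed
  moreover have "finite (rcosets\<^bsub>G_ex\<^esub> ?K)"
  proof -
    \<comment> \<open>The cosets of the kernel are the elements of the factor group, which embeds in
      a group with two elements.\<close>
    have "(\<lambda>Y. the_elem (?h ` Y)) \<in> hom (G_ex Mod ?K) ?C" by (rule h.FactGroup_hom)
    then have "(\<lambda>Y. the_elem (?h ` Y)) ` carrier (G_ex Mod ?K) \<subseteq> {0..<2}"
      by (auto simp: hom_def carrier_integer_mod_group)
    then have "finite (carrier (G_ex Mod ?K))"
      using inj_on_finite[OF h.FactGroup_inj_on] by blast
    then show ?thesis by (simp add: FactGroup_def)
  qed
  ultimately show ?thesis using K unfolding virtually_abelian_def by blast
qed

lemma symmetric_generating_Z_ex: "symmetric_generating_set G_ex Z_ex"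
proof -
  have sub: "Z_ex \<subseteq> carrier G_ex" using Z_ex_closed by blast
  have "inv\<^bsub>G_ex\<^esub> el_t = el_t"
    by (rule G_ex.inv_equality) (simp_all add: el_t_squared)
  then have "\<forall>z\<in>Z_ex. inv\<^bsub>G_ex\<^esub> z \<in> Z_ex" by (auto simp: Z_ex_def)
  moreover have "carrier G_ex \<subseteq> generate G_ex Z_ex"
  proof
    fix g assume g: "g \<in> carrier G_ex"
    obtain w where w: "w \<in> lists Z_ex" "coords (word_val G_ex w) = coords g"
      using exists_word[OF coords_carrier[OF g]] .
    have "word_val G_ex w \<in> generate G_ex Z_ex"
      using w(1)
      by (induction w)
        (auto simp: word_val_Nil word_val_Cons intro: generate.one generate.eng generate.incl)
    then show "g \<in> generate G_ex Z_ex"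
      using w g by (simp add: coords_eq_iff word_val_closed)
  qed
  ultimately show ?thesis
    using sub G_ex.generate_incl[OF sub] by (auto simp: symmetric_generating_set_def)
qed

theorem mainTheorem9:
  shows "G_ex \<cong> Z2_semidirect_C2 \<and>
         virtually_abelian G_ex \<and>
         symmetric_generating_set G_ex Z_ex \<and>
         regular_language Z_ex (ConjGeo G_ex Z_ex) \<and>
         \<not> regular_language Z_ex (UConjGeo G_ex Z_ex) \<and>
         \<not> (\<forall>(G :: gen gword set monoid) Z.
              group G \<and> virtually_abelian G \<and> finite Z \<and> symmetric_generating_set G Z \<and>
              regular_language Z (ConjGeo G Z) \<longrightarrow> regular_language Z (UConjGeo G Z))"
proof -
  \<comment> \<open>The universal implication is refuted by \<open>G_ex\<close> and
    \<open>Z_ex\<close> themselves; finiteness is the one hypothesis about them not yet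
    established.\<close>
  have "finite Z_ex" by (simp add: Z_ex_def)
  then show ?thesis
    using is_isoI[OF coords_iso] virtually_abelian_G_ex symmetric_generating_Z_ex
      regular_ConjGeo not_regular_UConjGeo G_ex.is_group by blast
qed

end
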